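(* Let $\overline{D},d,c_S,s_S,c_F,s_F>0$ satisfy $d>\overline{D}$, $c_F>c_S\overline{D}+s_S$, $s_F>s_S$ and $c_F>2s_S$ (so that the equilibrium commitment $k^*$ under perfect virtual trading satisfies $k^*>0$). Then perfect virtual trading decreases the expected side payments both in day-ahead and in real-time, compared with no virtual trading. That is, $$SP_{DA}^{VT}<SP_{DA}^{0}\qquad\text{and}\qquad \mathbb{E}_\epsilon\big(SP_{RT,\epsilon}(k^* )\big)<\mathbb{E}_\epsilon\big(SP_{RT,\epsilon}(0)\big),$$ where $SP_{DA}^{VT}$, $SP_{DA}^{0}$ are the day-ahead side payments with perfect virtual trading and without virtual trading, and $SP_{RT,\epsilon}(k)$ are the real-time side payments under shock $\epsilon$ when $k$ slow-start resources have been committed in day-ahead.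
   Context: Model. There is a day-ahead (DA) market followed by a real-time (RT) market. Inelastic demand is $d$ in DA and $d+\epsilon$ in RT, where $\epsilon$ is uniformly distributed on $[-\overline{D},\overline{D}]$. There is a base-load slow-start unit of capacity $d$ with marginal cost $0$ and fixed cost $s_S d$; a continuum of slow-start resources (SSR) with total cost $C_S(q)=\frac{c_S}{2}q^2+s_Sq$, which can be used in RT only if committed in DA (their start-up cost is then sunk); and a continuum of fast-start resources (FSR) with total cost $C_F(q)=c_Fq+s_Fq$, which can be started in RT. If an amount $k\in[0,\overline{D}]$ of SSR is committed in DA, then in RT: for $\epsilon<0$ the price is $0$; for $0\le\epsilon\le k$ it is $c_S\epsilon$; for $\epsilon>k$ an amount $\epsilon-k$ of FSR is activated and the price is $c_F$. Side payments offset the losses of producers that do not break even at the market price. The RT side payments cover the start-up costs of activated FSR: $SP_{RT,\epsilon}(k)=s_F\max(0,\epsilon-k)$. Given the DA price $p_{DA}$ and commitment $k$, the DA side payments are $$SP_{DA}=\max(0,\,s_Sd-p_{DA}d)+\int_0^k\max(0,\,c_Sq+s_S-p_{DA})\,dq .$$ Without virtual trading: $k=0$ and $p_{DA}=0$. Perfect virtual trading: virtual traders set the DA price, $p_{DA}(k)=c_Sk+s_S$, and the expected RT price is $$\mathbb{E}_\epsilon(p_{RT,\epsilon})(k)=\frac{1}{2\overline{D}}\Big(\int_0^kc_S\epsilon\,d\epsilon+\int_k^{\overline{D}}c_F\,d\epsilon\Big).$$ The equilibrium commitment $k^*$ is the $k\in[0,\overline{D}]$ satisfying the no-arbitrage condition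 $p_{DA}(k)=\mathbb{E}_\epsilon(p_{RT,\epsilon})(k)$, equivalently the root in $[0,\overline{D}]$ of $\frac{c_S}{2}k^2-(c_F+2c_S\overline{D})k+\overline{D}(c_F-2s_S)=0$. The DA side payments under perfect virtual trading are those computed at $k=k^*$, $p_{DA}=c_Sk^*+s_S$. *)

theory Defs
  imports "HOL-Probability.Probability"
begin

definition shock :: "real \<Rightarrow> real measure" where
  "shock D = uniform_measure lborel {- D..D}"

text \<open>Day-ahead side payments at commitment \<open>k\<close> and day-ahead price \<open>p\<close>: the loss of the
  base-load unit (capacity \<open>d\<close>, fixed cost \<open>s\<^sub>S d\<close>, marginal cost \<open>0\<close>), plus the losses of the
  committed slow-start resources.\<close>

definition SP_DA :: "real \<Rightarrow> real \<Rightarrow> real \<Rightarrow> real \<Rightarrow> real \<Rightarrow> real" where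
  "SP_DA d cS sS k p = max 0 (sS * d - p * d) + (LBINT q:{0..k}. max 0 (cS * q + sS - p))"

definition SP_RT :: "real \<Rightarrow> real \<Rightarrow> real \<Rightarrow> real" where
  "SP_RT sF k \<epsilon> = sF * max 0 (\<epsilon> - k)"

definition expected_SP_RT :: "real \<Rightarrow> real \<Rightarrow> real \<Rightarrow> real" where
  "expected_SP_RT D sF k = (\<integral>\<epsilon>. SP_RT sF k \<epsilon> \<partial>shock D)"

definition price_RT :: "real \<Rightarrow> real \<Rightarrow> real \<Rightarrow> real \<Rightarrow> real" where
  "price_RT cS cF k \<epsilon> = (if \<epsilon> < 0 then 0 else if \<epsilon> \<le> k then cS * \<epsilon> else cF)"

definition expected_price_RT :: "real \<Rightarrow> real \<Rightarrow> real \<Rightarrow> real \<Rightarrow> real" where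
  "expected_price_RT D cS cF k = (\<integral>\<epsilon>. price_RT cS cF k \<epsilon> \<partial>shock D)"

definition price_DA_VT :: "real \<Rightarrow> real \<Rightarrow> real \<Rightarrow> real" where
  "price_DA_VT cS sS k = cS * k + sS"

definition equilibrium_commitment :: "real \<Rightarrow> real \<Rightarrow> real \<Rightarrow> real \<Rightarrow> real \<Rightarrow> bool" where
  "equilibrium_commitment D cS sS cF k \<longleftrightarrow>
     k \<in> {0..D} \<and> price_DA_VT cS sS k = expected_price_RT D cS cF k"

definition k_star :: "real \<Rightarrow> real \<Rightarrow> real \<Rightarrow> real \<Rightarrow> real" where
  "k_star D cS sS cF = (THE k. equilibrium_commitment D cS sS cF k)"

definition SP_DA_no_VT :: "real \<Rightarrow> real \<Rightarrow> real \<Rightarrow> real" where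
  "SP_DA_no_VT d cS sS = SP_DA d cS sS 0 0"

definition SP_DA_VT :: "real \<Rightarrow> real \<Rightarrow> real \<Rightarrow> real \<Rightarrow> real \<Rightarrow> real" where
  "SP_DA_VT D d cS sS cF =
     (let k = k_star D cS sS cF in SP_DA d cS sS k (price_DA_VT cS sS k))"

lemma expected_price_RT_eq:
  assumes "0 < D" "0 \<le> k" "k \<le> D"
  shows "expected_price_RT D cS cF k =
    1 / (2 * D) * ((LBINT \<epsilon>:{0..k}. cS * \<epsilon>) + (LBINT \<epsilon>:{k..D}. cF))"
proof -
  have meas: "(\<lambda>\<epsilon>. price_RT cS cF k \<epsilon>) \<in> borel_measurable lborel"
    unfolding price_RT_def by measurable
  have int1: "set_integrable lborel {0..k} (\<lambda>\<epsilon>. cS * \<epsilon>)"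
    by (intro borel_integrable_atLeastAtMost') (intro continuous_intros)
  have int2: "set_integrable lborel {k..D} (\<lambda>\<epsilon>. cF)"
    by (intro borel_integrable_atLeastAtMost') (intro continuous_intros)
  have "shock D = density lborel (\<lambda>x. ennreal (indicator {-D..D} x / (2 * D)))"
    unfolding shock_def uniform_measure_def using assms
    by (intro density_cong) (auto simp: indicator_def divide_ennreal simp flip: ennreal_1)
  then have "expected_price_RT D cS cF k =
      (\<integral>\<epsilon>. (indicator {-D..D} \<epsilon> / (2 * D)) *\<^sub>R price_RT cS cF k \<epsilon> \<partial>lborel)"
    unfolding expected_price_RT_def using assms meas by (simp add: integral_density)
  also have "\<dots> = (\<integral>\<epsilon>. 1 / (2 * D) * (indicator {0..k} \<epsilon> *\<^sub>R (cS * \<epsilon>) +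
      indicator {k..D} \<epsilon> *\<^sub>R cF) \<partial>lborel)"
    using meas assms
    by (intro integral_cong_AE eventually_mono[OF AE_lborel_singleton[of k]])
       (auto simp: price_RT_def indicator_def)
  also have "\<dots> = 1 / (2 * D) * ((LBINT \<epsilon>:{0..k}. cS * \<epsilon>) + (LBINT \<epsilon>:{k..D}. cF))"
    using int1 int2 unfolding set_lebesgue_integral_def set_integrable_def
    by (subst integral_mult_right_zero, subst Bochner_Integration.integral_add) auto
  finally show ?thesis .
qed

end

theory Submission
  imports Defs
begin

text \<open>
  The expected real-time price at commitment \<open>k\<close> is a quadratic polynomial in \<open>k\<close>, so
  no-arbitrage says that \<open>excess D cS sS cF k = 0\<close>, where the excess is a positive multiple of
  the gap between the expected real-time price and the day-ahead price. This gap is strictly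
  decreasing on \<open>[0, D]\<close> (\<open>excess_strict_antimono\<close>), because a larger commitment raises the
  day-ahead price and replaces dearer fast-start units in real-time. It is positive at \<open>0\<close>,
  where fast-start units set the price for half of the shocks and so the expected price is
  \<open>cF / 2 > sS\<close>. It is negative at \<open>D\<close>, where fast-start units never set the price and the
  expected price is \<open>cS * D / 4 < cS * D + sS\<close>. Hence there is exactly one equilibrium, and it is positive.

  In day-ahead, virtual trading sets the price at the cost of the marginal committed unit.
  This covers all committed units and the fixed cost \<open>sS\<close> of the base-load unit, so no side
  payment is left (\<open>SP_DA_marginal_cost_price\<close>), whereas at price \<open>0\<close> the
  base-load unit loses \<open>sS * d > 0\<close>. In real-time the expected side payment is
  \<open>sF * (D - k)\<^sup>2 / (4 * D)\<close> (\<open>expected_SP_RT_eq\<close>), which is strictly smaller at the positive commitment \<open>k_star\<close> than at \<open>0\<close>.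
\<close>

lemma set_integral_affine:
  fixes a b m k :: real
  assumes "a \<le> b"
  shows "(LBINT x:{a..b}. m * (x - k)) = m * ((b - k)\<^sup>2 - (a - k)\<^sup>2) / 2"
proof -
  have "(LBINT x:{a..b}. m * (x - k)) = m * (b - k)\<^sup>2 / 2 - m * (a - k)\<^sup>2 / 2"
    unfolding set_lebesgue_integral_def
    by (rule integral_FTC_atLeastAtMost[OF assms])
      (auto intro!: derivative_eq_intros continuous_intros
        simp flip: has_real_derivative_iff_has_vector_derivative)
  then show ?thesis
    by (simp add: algebra_simps diff_divide_distrib)
qed

text \<open>
  For \<open>k\<close> in \<open>[0, D]\<close> this is \<open>2 * D * (expected_price_RT D cS cF k - price_DA_VT cS sS k)\<close>. The
  factor \<open>2 * D\<close> clears the density \<open>1 / (2 * D)\<close> of the shock.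
\<close>

definition excess :: "real \<Rightarrow> real \<Rightarrow> real \<Rightarrow> real \<Rightarrow> real \<Rightarrow> real" where
  "excess D cS sS cF k = cS / 2 * k\<^sup>2 - (cF + 2 * cS * D) * k + D * (cF - 2 * sS)"

lemma equilibrium_commitment_iff_excess:
  assumes "D > 0"
  shows "equilibrium_commitment D cS sS cF k \<longleftrightarrow> k \<in> {0..D} \<and> excess D cS sS cF k = 0"
proof (cases "k \<in> {0..D}")
  case True
  then have k: "0 \<le> k" "k \<le> D" by auto
  have "(LBINT \<epsilon>:{0..k}. cS * \<epsilon>) = cS * k\<^sup>2 / 2"
    using set_integral_affine[OF k(1), of cS 0] by simp
  moreover have "(LBINT \<epsilon>:{k..D}. cF) = cF * (D - k)"
    using k by (simp add: set_lebesgue_integral_def)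
  ultimately have "expected_price_RT D cS cF k = 1 / (2 * D) * (cS * k\<^sup>2 / 2 + cF * (D - k))"
    using expected_price_RT_eq[OF assms k] by simp
  also have "\<dots> = price_DA_VT cS sS k + excess D cS sS cF k / (2 * D)"
    using assms by (simp add: price_DA_VT_def excess_def field_simps)
  finally show ?thesis
    using True assms by (auto simp: equilibrium_commitment_def)
qed (auto simp: equilibrium_commitment_def)

text \<open>
  The vertex of the parabola is at \<open>2 * D + cF / cS\<close>, to the right of \<open>[0, D]\<close>.
\<close>

lemma excess_strict_antimono:
  assumes "cS > 0" "cF > 0" "0 \<le> x" "x < y" "y \<le> D"
  shows "excess D cS sS cF y < excess D cS sS cF x"
proof -
  have "excess D cS sS cF x - excess D cS sS cF y
      = (y - x) * (cF + cS * (2 * D - (x + y) / 2))"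
    by (simp add: excess_def power2_eq_square field_simps)
  moreover have "cS * (2 * D - (x + y) / 2) > 0"
    using assms by (intro mult_pos_pos) auto
  then have "(y - x) * (cF + cS * (2 * D - (x + y) / 2)) > 0"
    using assms by (intro mult_pos_pos add_pos_pos) auto
  ultimately show ?thesis by linarith
qed

lemma ex1_equilibrium_commitment:
  assumes "D > 0" "cS > 0" "sS > 0" "cF > 2 * sS"
  shows "\<exists>!k. equilibrium_commitment D cS sS cF k"
proof -
  have "excess D cS sS cF 0 \<ge> 0"
    using assms by (simp add: excess_def)
  moreover have "excess D cS sS cF D = - (3 / 2 * cS * D\<^sup>2 + 2 * D * sS)"
    by (simp add: excess_def power2_eq_square field_simps)
  moreover have "3 / 2 * cS * D\<^sup>2 + 2 * D * sS \<ge> 0"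
    using assms by (intro add_nonneg_nonneg mult_nonneg_nonneg) auto
  ultimately have "excess D cS sS cF 0 \<ge> 0" "excess D cS sS cF D \<le> 0"
    by linarith+
  moreover have "continuous_on {0..D} (excess D cS sS cF)"
    unfolding excess_def by (intro continuous_intros)
  ultimately obtain k where "k \<in> {0..D}" "excess D cS sS cF k = 0"
    using IVT2'[of "excess D cS sS cF" D 0 0] assms by force
  moreover have "x = y"
    if "x \<in> {0..D}" "y \<in> {0..D}" "excess D cS sS cF x = 0" "excess D cS sS cF y = 0" for x y
    using that excess_strict_antimono[of cS cF x y D sS] excess_strict_antimono[of cS cF y x D sS]
      assms by (cases x y rule: linorder_cases) auto
  ultimately show ?thesis
    unfolding equilibrium_commitment_iff_excess[OF assms(1)]
    by blast
qed

lemma equilibrium_commitment_pos: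
  assumes "equilibrium_commitment D cS sS cF k" "D > 0" "cF > 2 * sS"
  shows "k > 0"
proof -
  have "excess D cS sS cF 0 > 0"
    using assms by (simp add: excess_def)
  then show ?thesis
    using assms by (cases "k = 0") (auto simp: equilibrium_commitment_iff_excess)
qed

text \<open>
  The unit cost \<open>cS * q + sS\<close> does not decrease in \<open>q\<close>, so a price equal to the cost of the last
  committed unit covers every earlier unit, and it is at least \<open>sS\<close>, the unit cost of the base load.
\<close>

lemma SP_DA_marginal_cost_price:
  assumes "d \<ge> 0" "cS \<ge> 0" "k \<ge> 0"
  shows "SP_DA d cS sS k (price_DA_VT cS sS k) = 0"
proof -
  have "(LBINT q:{0..k}. max 0 (cS * q + sS - price_DA_VT cS sS k)) = (LBINT q:{0..k}. 0)"
    using assms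
    by (intro set_lebesgue_integral_cong)
      (auto simp: price_DA_VT_def max_def intro: antisym mult_left_mono)
  moreover have "sS * d - price_DA_VT cS sS k * d \<le> 0"
    using assms by (simp add: price_DA_VT_def algebra_simps)
  ultimately show ?thesis
    by (simp add: SP_DA_def)
qed

lemma SP_DA_no_VT_eq:
  assumes "d \<ge> 0" "sS \<ge> 0"
  shows "SP_DA_no_VT d cS sS = sS * d"
proof -
  \<comment> \<open>Nothing is committed, so the integral over committed units is over a null set.\<close>
  have "(LBINT q:{0..0}. max 0 (cS * q + sS - 0)) = 0"
    unfolding set_lebesgue_integral_def
    by (intro integral_eq_zero_AE eventually_mono[OF AE_lborel_singleton[of 0]]) auto
  then show ?thesis
    using assms by (simp add: SP_DA_no_VT_def SP_DA_def)
qed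

lemma integral_shock:
  fixes f :: "real \<Rightarrow> real"
  assumes "D > 0" and [measurable]: "f \<in> borel_measurable borel"
  shows "(\<integral>\<epsilon>. f \<epsilon> \<partial>shock D) = (LBINT \<epsilon>:{-D..D}. f \<epsilon>) / (2 * D)"
proof -
  have "shock D = density lborel (\<lambda>x. ennreal (indicator {-D..D} x / (2 * D)))"
    unfolding shock_def uniform_measure_def using assms
    by (intro density_cong) (auto simp: indicator_def divide_ennreal simp flip: ennreal_1)
  then show ?thesis
    using assms by (simp add: integral_density set_lebesgue_integral_def)
qed

text \<open>
  Only the shocks in \<open>[k, D]\<close> activate fast-start units, and over them the activated amount
  \<open>\<epsilon> - k\<close> sweeps a triangle of area \<open>(D - k)\<^sup>2 / 2\<close>.
\<close>

lemma expected_SP_RT_eq: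
  assumes "D > 0" "0 \<le> k" "k \<le> D"
  shows "expected_SP_RT D sF k = sF * (D - k)\<^sup>2 / (4 * D)"
proof -
  have "(LBINT \<epsilon>:{-D..D}. SP_RT sF k \<epsilon>) = (LBINT \<epsilon>:{k..D}. sF * (\<epsilon> - k))"
    unfolding set_lebesgue_integral_def using assms
    by (intro Bochner_Integration.integral_cong) (auto simp: SP_RT_def indicator_def)
  also have "\<dots> = sF * (D - k)\<^sup>2 / 2"
    using set_integral_affine[OF assms(3), of sF k] by simp
  finally have "(LBINT \<epsilon>:{-D..D}. SP_RT sF k \<epsilon>) = sF * (D - k)\<^sup>2 / 2" .
  moreover have "SP_RT sF k \<in> borel_measurable borel"
    unfolding SP_RT_def by measurable
  ultimately show ?thesis
    using assms by (simp add: expected_SP_RT_def integral_shock field_simps)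
qed

theorem proposition2:
  fixes D d cS sS cF sF :: real
  assumes "D > 0" and "d > 0" and "cS > 0" and "sS > 0" and "cF > 0" and "sF > 0"
    and "d > D"
    and "cF > cS * D + sS"
    and "sF > sS"
    and "cF > 2 * sS"
  shows "(\<exists>!k. equilibrium_commitment D cS sS cF k)
    \<and> k_star D cS sS cF > 0
    \<and> SP_DA_VT D d cS sS cF < SP_DA_no_VT d cS sS
    \<and> expected_SP_RT D sF (k_star D cS sS cF) < expected_SP_RT D sF 0"
proof -
  define k where "k = k_star D cS sS cF"
  have ex1: "\<exists>!k. equilibrium_commitment D cS sS cF k"
    using assms by (intro ex1_equilibrium_commitment)
  then have eq: "equilibrium_commitment D cS sS cF k"
    unfolding k_def k_star_def by (rule theI')
  then have k: "0 < k" "k \<le> D"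
    using assms equilibrium_commitment_pos by (auto simp: equilibrium_commitment_def)
  have "SP_DA_VT D d cS sS cF = 0"
    using SP_DA_marginal_cost_price[of d cS k sS] assms k
    by (simp add: SP_DA_VT_def Let_def k_def)
  moreover have "SP_DA_no_VT d cS sS > 0"
    using assms by (simp add: SP_DA_no_VT_eq)
  moreover have "(D - k)\<^sup>2 < D\<^sup>2"
    using k by (intro power_strict_mono) auto
  then have "expected_SP_RT D sF k < expected_SP_RT D sF 0"
    using assms k by (simp add: expected_SP_RT_eq divide_strict_right_mono)
  ultimately show ?thesis
    using ex1 k unfolding k_def by simp
qed

end
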